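(* Let $\varphi$ be a monotone DNF or a monotone CNF, let $a$ be its arity and $d$ its degree. Then any OBDD for $\varphi$ has width at least $$2^{\left\lfloor\frac{\mathrm{pw}(\varphi)}{a^3\times d^2}\right\rfloor}.$$
   Context: A monotone DNF (resp. monotone CNF) on a finite set of variables $V$ is a disjunction of conjunctions (resp. conjunction of disjunctions) of variables of $V$; each such conjunction (resp. disjunction) is a clause, identified with the set of variables it contains. Monotone DNFs and CNFs are always assumed minimized (no clause is a subset of another) and to contain at least one non-empty clause. The hypergraph of $\varphi$ has the variables as vertices and the clauses as hyperedges. The arity of $\varphi$ is the maximal size of a hyperedge; the degree is the maximal number of hyperedges containing a given vertex. $\mathrm{pw}(\varphi)$ is the pathwidth of the hypergraph of $\varphi$: the minimal width of a path decomposition, i.e. of a path whose nodes (bags) are labeled by subsets of the vertices such that every hyperedge is contained in some bag and for each vertex the bags containing it form a connected subpath; width is the maximal bag size minus one. An OBDD on variables $V=\{v_1,\dots,v_n\}$ is a rooted DAG whose leaves are labeled $0$ or $1$ and whose internal nodes are labeled by a variable and have two outgoing edges labeled $0$ and $1$, such that for some total order $\mathbf v$ on $V$, for every path from the root to a leaf, the sequence of variables labeling its internal nodes is a subsequence of $\mathbf v$ without duplicates. It captures the Boolean function mapping each valuation $\nu$ to the label of the leaf reached from the root by following $\nu$; it is an OBDD for $\varphi$ if it captures the function of $\varphi$. Its width is the maximum number of nodes at a level, where the level for a prefix of $\mathbf v$ is the set of nodes reached from the root by enumerating all possible valuations of this prefix. *)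

theory Defs
  imports Main "HOL-Library.Sublist"
begin

section \<open>Monotone DNFs and CNFs\<close>

datatype 'v monotone_nf =
    DNF (nf_clauses: "'v set set")
  | CNF (nf_clauses: "'v set set")

fun nf_eval :: "'v monotone_nf \<Rightarrow> ('v \<Rightarrow> bool) \<Rightarrow> bool" where
  "nf_eval (DNF C) \<nu> \<longleftrightarrow> (\<exists>c\<in>C. \<forall>x\<in>c. \<nu> x)"
| "nf_eval (CNF C) \<nu> \<longleftrightarrow> (\<forall>c\<in>C. \<exists>x\<in>c. \<nu> x)"

definition monotone_nf_on :: "'v set \<Rightarrow> 'v monotone_nf \<Rightarrow> bool" where
  "monotone_nf_on V \<phi> \<longleftrightarrow>
     finite V \<and>
     (\<forall>c\<in>nf_clauses \<phi>. c \<subseteq> V) \<and>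
     (\<forall>c\<in>nf_clauses \<phi>. \<forall>c'\<in>nf_clauses \<phi>. c \<subseteq> c' \<longrightarrow> c = c') \<and>
     (\<exists>c\<in>nf_clauses \<phi>. c \<noteq> {})"


section \<open>Hypergraph parameters\<close>

text \<open>A hypergraph is given by its vertex set and its set of hyperedges.\<close>

definition hyp_arity :: "'v set set \<Rightarrow> nat" where
  "hyp_arity E = Max (card ` E)"

definition hyp_degree :: "'v set \<Rightarrow> 'v set set \<Rightarrow> nat" where
  "hyp_degree V E = Max ((\<lambda>v. card {e \<in> E. v \<in> e}) ` V)"

definition path_decomposition :: "'v set \<Rightarrow> 'v set set \<Rightarrow> 'v set list \<Rightarrow> bool" where
  "path_decomposition V E bs \<longleftrightarrow>
     bs \<noteq> [] \<and>
     (\<forall>b\<in>set bs. b \<subseteq> V) \<and>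
     (\<forall>e\<in>E. \<exists>b\<in>set bs. e \<subseteq> b) \<and>
     (\<forall>v\<in>V. \<forall>i j k. i \<le> j \<and> j \<le> k \<and> k < length bs \<and> v \<in> bs ! i \<and> v \<in> bs ! k
        \<longrightarrow> v \<in> bs ! j)"

text \<open>The subtraction does not truncate as soon as some hyperedge is non-empty, since
  some bag is then non-empty.\<close>

definition decomposition_width :: "'v set list \<Rightarrow> nat" where
  "decomposition_width bs = Max (card ` set bs) - 1"

definition hyp_pathwidth :: "'v set \<Rightarrow> 'v set set \<Rightarrow> nat" where
  "hyp_pathwidth V E = (LEAST w. \<exists>bs. path_decomposition V E bs \<and> w = decomposition_width bs)"


section \<open>OBDDs\<close>

text \<open>A \<open>Branch x l h\<close> node tests \<open>x\<close>; its edge labeled 0 leads to \<open>l\<close> and its edge labeled 1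
  leads to \<open>h\<close>.\<close>

datatype ('v, 'n) bdd_node = Leaf bool | Branch 'v 'n 'n

record ('v, 'n) bdd =
  bdd_nodes :: "'n set"
  bdd_root :: 'n
  bdd_label :: "'n \<Rightarrow> ('v, 'n) bdd_node"

definition bdd_edges :: "('v, 'n) bdd \<Rightarrow> ('n \<times> 'n) set" where
  "bdd_edges D =
     {(u, w). u \<in> bdd_nodes D \<and> (\<exists>x l h. bdd_label D u = Branch x l h \<and> w \<in> {l, h})}"

definition rooted_dag :: "('v, 'n) bdd \<Rightarrow> bool" where
  "rooted_dag D \<longleftrightarrow>
     finite (bdd_nodes D) \<and>
     bdd_root D \<in> bdd_nodes D \<and>
     bdd_edges D \<subseteq> bdd_nodes D \<times> bdd_nodes D \<and>
     acyclic (bdd_edges D)"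

text \<open>\<open>leaf_path D u xs\<close>: some path from \<open>u\<close> to a leaf has the sequence \<open>xs\<close> of variables on
  its internal nodes.\<close>

inductive leaf_path :: "('v, 'n) bdd \<Rightarrow> 'n \<Rightarrow> 'v list \<Rightarrow> bool" for D where
  leaf: "bdd_label D u = Leaf b \<Longrightarrow> leaf_path D u []"
| branch: "bdd_label D u = Branch x l h \<Longrightarrow> w \<in> {l, h} \<Longrightarrow> leaf_path D w xs
           \<Longrightarrow> leaf_path D u (x # xs)"

text \<open>The list \<open>vs\<close> is the total order on \<open>V\<close>. It is distinct, so every subsequence of it is
  free of duplicates.\<close>

definition obdd :: "'v set \<Rightarrow> 'v list \<Rightarrow> ('v, 'n) bdd \<Rightarrow> bool" where
  "obdd V vs D \<longleftrightarrow>
     distinct vs \<and> set vs = V \<and>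
     rooted_dag D \<and>
     (\<forall>u\<in>bdd_nodes D. \<forall>x l h. bdd_label D u = Branch x l h \<longrightarrow> x \<in> V) \<and>
     (\<forall>xs. leaf_path D (bdd_root D) xs \<longrightarrow> subseq xs vs)"

text \<open>\<open>follows D P \<nu> u w\<close>: the walk from \<open>u\<close> that follows the valuation \<open>\<nu>\<close> of the variables
  in \<open>P\<close> ends in \<open>w\<close>, the first node that is a leaf or tests a variable outside \<open>P\<close>. Only the
  values of \<open>\<nu>\<close> on \<open>P\<close> are used.\<close>

inductive follows :: "('v, 'n) bdd \<Rightarrow> 'v set \<Rightarrow> ('v \<Rightarrow> bool) \<Rightarrow> 'n \<Rightarrow> 'n \<Rightarrow> bool"
  for D P \<nu> where
  stop_leaf: "bdd_label D u = Leaf b \<Longrightarrow> follows D P \<nu> u u"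
| stop_branch: "bdd_label D u = Branch x l h \<Longrightarrow> x \<notin> P \<Longrightarrow> follows D P \<nu> u u"
| step: "bdd_label D u = Branch x l h \<Longrightarrow> x \<in> P \<Longrightarrow> follows D P \<nu> (if \<nu> x then h else l) w
         \<Longrightarrow> follows D P \<nu> u w"

definition captures :: "'v set \<Rightarrow> ('v, 'n) bdd \<Rightarrow> (('v \<Rightarrow> bool) \<Rightarrow> bool) \<Rightarrow> bool" where
  "captures V D f \<longleftrightarrow>
     (\<forall>\<nu>. \<exists>w. follows D V \<nu> (bdd_root D) w \<and> bdd_label D w = Leaf (f \<nu>))"

definition obdd_for :: "'v set \<Rightarrow> 'v list \<Rightarrow> ('v, 'n) bdd \<Rightarrow> 'v monotone_nf \<Rightarrow> bool" where
  "obdd_for V vs D \<phi> \<longleftrightarrow> obdd V vs D \<and> captures V D (nf_eval \<phi>)"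

definition obdd_level :: "('v, 'n) bdd \<Rightarrow> 'v list \<Rightarrow> 'n set" where
  "obdd_level D p = {w. \<exists>\<nu>. follows D (set p) \<nu> (bdd_root D) w}"

definition obdd_width :: "'v list \<Rightarrow> ('v, 'n) bdd \<Rightarrow> nat" where
  "obdd_width vs D = Max ((\<lambda>p. card (obdd_level D p)) ` {p. prefix p vs})"

end

(* A path decomposition read off the variable order shows that some prefix of the order has at
   least pw variables sharing a clause with a later variable, hence at least pw / a clauses are cut
   by this prefix. As each clause is at distance at most two of at most a^2 d^2 clauses, a maximal
   set of cut clauses, no two of which are met by a common clause, has at least pw / (a^3 d^2)
   elements. For a DNF, by minimality of the clauses, setting to 1 the prefix parts of different
   subsets of these clauses gives different subfunctions, hence different nodes of the level. A CNF
   is handled by negating all valuations. *)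

theory Submission imports Defs begin

section \<open>Levels of OBDDs\<close>

lemma follows_deterministic:
  "follows D P \<nu> u w \<Longrightarrow> follows D P \<nu> u w' \<Longrightarrow> w = w'"
  by (induction rule: follows.induct) (auto elim: follows.cases)

text \<open>The walk for the smaller set \<open>P\<close> is an initial segment of the walk for
  \<open>V\<close>, so the latter passes through \<open>w\<close>.\<close>

lemma follows_continue:
  assumes "follows D P \<nu> u w" "follows D V \<nu> u l" "P \<subseteq> V"
  shows "follows D V \<nu> w l"
  using assms
proof (induction rule: follows.induct)
  case (step u x l' h w)
  from step.prems(1) have "follows D V \<nu> (if \<nu> x then h else l') l"
    using step.hyps step.prems(2) by cases auto
  then show ?case using step by blast
qed auto

text \<open>Termination is inherited: the walk for \<open>P\<close> is an initial segment of the
  walk for \<open>V\<close>, which is known to end in a leaf.\<close>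

lemma follows_exists_prefix:
  "follows D V \<nu> u l \<Longrightarrow> bdd_label D l = Leaf b \<Longrightarrow> \<exists>w. follows D P \<nu> u w"
proof (induction rule: follows.induct)
  case (stop_leaf u)
  then show ?case by (meson follows.stop_leaf)
next
  case (stop_branch u x l h)
  then show ?case by simp
next
  case (step u x l h w)
  then show ?case by (meson follows.stop_branch follows.step)
qed

lemma follows_cong:
  assumes "follows D P \<nu> u w" "\<And>x. x \<in> P \<Longrightarrow> \<nu> x = \<nu>' x"
  shows "follows D P \<nu>' u w"
  using assms by (induction rule: follows.induct) (auto intro: follows.intros)

text \<open>The order condition speaks of paths that start at the root; prepending a walk to a path
  below its end transfers the condition to the nodes of a level.\<close>

lemma follows_leaf_path:
  "follows D P \<nu> u w \<Longrightarrow> leaf_path D w ys \<Longrightarrow> \<exists>zs. leaf_path D u (zs @ ys)"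
proof (induction rule: follows.induct)
  case (stop_leaf u b)
  then show ?case by (metis append_Nil)
next
  case (stop_branch u x l h)
  then show ?case by (metis append_Nil)
next
  case (step u x l h w)
  then obtain zs where "leaf_path D (if \<nu> x then h else l) (zs @ ys)" by blast
  then have "leaf_path D u ((x # zs) @ ys)"
    using leaf_path.branch[OF step.hyps(1), of "if \<nu> x then h else l" "zs @ ys"] by simp
  then show ?case by blast
qed

lemma follows_in_nodes:
  assumes "follows D P \<nu> u w" "bdd_edges D \<subseteq> bdd_nodes D \<times> bdd_nodes D" "u \<in> bdd_nodes D"
  shows "w \<in> bdd_nodes D"
  using assms
proof (induction rule: follows.induct)
  case (step u x l h w)
  then have "(u, if \<nu> x then h else l) \<in> bdd_edges D"
    by (auto simp: bdd_edges_def)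
  then show ?case using step by blast
qed auto

text \<open>The walk from \<open>w\<close> never reads the variables on which the two valuations may
  differ.\<close>

lemma follows_avoiding_cong:
  assumes "follows D V \<nu> w l" "bdd_label D l = Leaf b"
    and "\<And>xs. leaf_path D w xs \<Longrightarrow> set xs \<inter> P = {}"
    and "\<And>x. x \<notin> P \<Longrightarrow> \<nu> x = \<nu>' x"
  shows "follows D V \<nu>' w l"
  using assms
proof (induction rule: follows.induct)
  case (step u x l' h w)
  let ?c = "if \<nu> x then h else l'"
  \<comment> \<open>The hypothesis on leaf paths excludes \<open>x\<close> from \<open>P\<close>
    only once such a path through \<open>u\<close> is exhibited; the walk itself supplies one, as it
    ends in a leaf.\<close>
  obtain zs where zs: "leaf_path D ?c zs"
    using follows_leaf_path[OF step.hyps(3)] leaf_path.leaf[OF step.prems(1)] by blast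
  have extend: "leaf_path D u (x # xs)" if "leaf_path D ?c xs" for xs
    using leaf_path.branch[OF step.hyps(1) _ that] by auto
  have "x \<notin> P"
    using step.prems(2)[OF extend[OF zs]] by auto
  then have "\<nu> x = \<nu>' x" using step.prems(3) by blast
  moreover have "follows D V \<nu>' ?c w"
  proof (rule step.IH[OF step.prems(1)])
    show "set xs \<inter> P = {}" if "leaf_path D ?c xs" for xs
      using step.prems(2)[OF extend[OF that]] by auto
  qed (use step.prems(3) in blast)
  ultimately show ?case using step.hyps(1,2) by (simp add: follows.step)
qed (auto intro: follows.intros)

text \<open>The walk stops at \<open>w\<close>, so the first variable \<open>x\<close> tested from
  there on is outside \<open>p\<close>. The path is the tail of a subsequence of
  \<open>p @ q\<close>, and such a sequence never returns to \<open>p\<close> after leaving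
  it.\<close>

lemma leaf_path_from_level:
  assumes "obdd V (p @ q) D" "follows D (set p) \<nu> (bdd_root D) w" "leaf_path D w xs"
  shows "set xs \<inter> set p = {}"
proof (cases xs)
  case (Cons x ys)
  from assms(3) Cons obtain l h where lab: "bdd_label D w = Branch x l h"
    by (auto elim: leaf_path.cases)
  have "x \<notin> set p" using assms(2) lab by induction auto
  obtain zs where "leaf_path D (bdd_root D) (zs @ xs)"
    using follows_leaf_path[OF assms(2,3)] by blast
  then have "subseq xs (p @ q)"
    using assms(1) unfolding obdd_def by (metis subseq_order.trans subseq_append_iff 
        list_emb_append2 subseq_order.order_refl)
  then obtain xs1 xs2 where s: "xs = xs1 @ xs2" "subseq xs1 p" "subseq xs2 q"
    by (auto simp: subseq_append_iff)
  have sub: "set us \<subseteq> set ws" if "subseq us ws" for us ws :: "'a list"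
    using list_emb_set[OF that] by blast
  \<comment> \<open>A non-empty \<open>xs1\<close> would start with \<open>x\<close> and so place
    \<open>x\<close> in \<open>p\<close>.\<close>
  have "xs1 = []"
  proof (cases xs1)
    case (Cons y ys')
    then have "x \<in> set xs1" using s(1) \<open>xs = x # ys\<close> by simp
    then show ?thesis using sub[OF s(2)] \<open>x \<notin> set p\<close> by blast
  qed
  then have "set xs \<subseteq> set q" using s(1) sub[OF s(3)] by simp
  moreover have "set p \<inter> set q = {}" using assms(1) by (auto simp: obdd_def)
  ultimately show ?thesis by blast
qed auto

text \<open>Both valuations reach \<open>w\<close>, and below \<open>w\<close> only variables
  outside \<open>p\<close> are tested, where they agree; hence they end in the same leaf.\<close>

lemma same_level_node_same_value:
  assumes D: "obdd V (p @ q) D" "captures V D f"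
    and w: "follows D (set p) \<sigma> (bdd_root D) w" "follows D (set p) \<tau> (bdd_root D) w"
    and eq: "\<And>x. x \<notin> set p \<Longrightarrow> \<sigma> x = \<tau> x"
  shows "f \<sigma> = f \<tau>"
proof -
  have sub: "set p \<subseteq> V" using D(1) by (auto simp: obdd_def)
  obtain l where l: "follows D V \<sigma> (bdd_root D) l" "bdd_label D l = Leaf (f \<sigma>)"
    using D(2) by (auto simp: captures_def)
  obtain l' where l': "follows D V \<tau> (bdd_root D) l'" "bdd_label D l' = Leaf (f \<tau>)"
    using D(2) by (auto simp: captures_def)
  have "follows D V \<tau> w l"
    using follows_continue[OF w(1) l(1) sub] l(2) leaf_path_from_level[OF D(1) w(1)] eq
    by (rule follows_avoiding_cong)
  moreover have "follows D V \<tau> w l'"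
    using follows_continue[OF w(2) l'(1) sub] .
  ultimately have "l = l'" by (rule follows_deterministic)
  then show ?thesis using l(2) l'(2) by simp
qed

text \<open>A fooling set argument: prefix valuations inducing different subfunctions must reach
  different nodes of the level of \<open>p\<close>. The completions \<open>\<sigma>\<close> and
  \<open>\<tau>\<close> may depend on the pair \<open>s\<close>, \<open>t\<close>, but the prefix
  valuation \<open>\<nu> s\<close> only on \<open>s\<close>.\<close>

lemma card_distinguishable_le_width:
  fixes \<nu> :: "'s \<Rightarrow> 'v \<Rightarrow> bool"
  assumes D: "obdd V (p @ q) D" "captures V D f"
    and dist: "\<And>s t. s \<in> A \<Longrightarrow> t \<in> A \<Longrightarrow> s \<noteq> t \<Longrightarrow> \<exists>\<sigma> \<tau>. f \<sigma> \<noteq> f \<tau> \<and>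
      (\<forall>x\<in>set p. \<sigma> x = \<nu> s x \<and> \<tau> x = \<nu> t x) \<and> (\<forall>x. x \<notin> set p \<longrightarrow> \<sigma> x = \<tau> x)"
  shows "card A \<le> obdd_width (p @ q) D"
proof -
  let ?L = "obdd_level D p"
  have "\<exists>w. follows D (set p) (\<nu> s) (bdd_root D) w" for s
  proof -
    obtain l where "follows D V (\<nu> s) (bdd_root D) l" "bdd_label D l = Leaf (f (\<nu> s))"
      using D(2) by (auto simp: captures_def)
    then show ?thesis by (rule follows_exists_prefix)
  qed
  then obtain g where g: "\<And>s. follows D (set p) (\<nu> s) (bdd_root D) (g s)" by metis
  have "inj_on g A"
  proof (rule inj_onI, rule ccontr)
    fix s t assume st: "s \<in> A" "t \<in> A" "g s = g t" "s \<noteq> t"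
    then obtain \<sigma> \<tau> where *: "f \<sigma> \<noteq> f \<tau>" "\<forall>x\<in>set p. \<sigma> x = \<nu> s x \<and> \<tau> x = \<nu> t x"
      "\<forall>x. x \<notin> set p \<longrightarrow> \<sigma> x = \<tau> x"
      using dist by metis
    have "follows D (set p) \<sigma> (bdd_root D) (g s)"
      using follows_cong[OF g, where \<nu>' = \<sigma>] *(2) by simp
    moreover have "follows D (set p) \<tau> (bdd_root D) (g s)"
      using follows_cong[OF g, where \<nu>' = \<tau>] *(2) st(3) by simp
    ultimately have "f \<sigma> = f \<tau>"
      using same_level_node_same_value[OF D] *(3) by blast
    with *(1) show False by simp
  qed
  moreover have "g ` A \<subseteq> ?L" using g by (auto simp: obdd_level_def)
  moreover have "finite ?L"
  proof -
    have nodes: "bdd_edges D \<subseteq> bdd_nodes D \<times> bdd_nodes D" "bdd_root D \<in> bdd_nodes D"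
      "finite (bdd_nodes D)"
      using D(1) by (simp_all add: obdd_def rooted_dag_def)
    have "?L \<subseteq> bdd_nodes D"
      using follows_in_nodes[OF _ nodes(1,2)] by (auto simp: obdd_level_def)
    then show ?thesis using nodes(3) by (rule finite_subset)
  qed
  ultimately have "card A \<le> card ?L" by (rule card_inj_on_le)
  also have "\<dots> \<le> obdd_width (p @ q) D"
    unfolding obdd_width_def
  proof (rule Max_ge)
    have "{r. prefix r (p @ q)} = set (prefixes (p @ q))" by auto
    then show "finite ((\<lambda>r. card (obdd_level D r)) ` {r. prefix r (p @ q)})" by simp
  qed auto
  finally show ?thesis .
qed

section \<open>Pathwidth and cuts of a vertex order\<close>

text \<open>The largest boundary over the prefixes of an order is the vertex separation of this
  order in the primal graph.\<close>

definition boundary :: "'v set set \<Rightarrow> 'v set \<Rightarrow> 'v set" where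
  "boundary E P = {v \<in> P. \<exists>e\<in>E. v \<in> e \<and> \<not> e \<subseteq> P}"

definition cut_edges :: "'v set set \<Rightarrow> 'v set \<Rightarrow> 'v set set" where
  "cut_edges E P = {e \<in> E. e \<inter> P \<noteq> {} \<and> \<not> e \<subseteq> P}"

text \<open>Bag \<open>i\<close> holds vertex \<open>i\<close> and the earlier vertices that share
  an edge with a vertex at position \<open>i\<close> or later. So an edge lies in the bag of its
  last vertex, and a vertex occupies the interval from its own position to the last position in any
  edge through it.\<close>

lemma path_decomposition_of_order:
  assumes vs: "distinct vs" "set vs = V" "vs \<noteq> []"
    and E: "\<And>e. e \<in> E \<Longrightarrow> e \<subseteq> V" "{} \<notin> E"
  shows "path_decomposition V E
    (map (\<lambda>i. insert (vs ! i) (boundary E (set (take i vs)))) [0..<length vs])"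
    (is "path_decomposition V E (map ?B _)")
proof -
  let ?n = "length vs"
  have mem: "vs ! j \<in> set (take i vs) \<longleftrightarrow> j < i" if "j < ?n" "i \<le> ?n" for i j
    using that vs(1) by (auto simp: in_set_conv_nth nth_eq_iff_index_eq)
  have cover: "\<exists>b\<in>set (map ?B [0..<?n]). e \<subseteq> b" if e: "e \<in> E" for e
  proof -
    let ?J = "{j. j < ?n \<and> vs ! j \<in> e}"
    define m where "m = Max ?J"
    obtain y where y: "y \<in> e" using e E(2) by fastforce
    then have "y \<in> set vs" using E(1)[OF e] vs(2) by auto
    then obtain j where "j < ?n" "vs ! j = y" by (auto simp: in_set_conv_nth)
    then have "?J \<noteq> {}" using y by auto
    then have m: "m < ?n" "vs ! m \<in> e"
      using Max_in[of ?J] by (auto simp: m_def)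
    have "e \<subseteq> ?B m"
    proof
      fix x assume x: "x \<in> e"
      then have "x \<in> set vs" using E(1)[OF e] vs(2) by auto
      then obtain j where j: "j < ?n" "vs ! j = x" by (auto simp: in_set_conv_nth)
      then have "j \<le> m" using x by (auto simp: m_def)
      then show "x \<in> ?B m"
        using j x m e mem[of j m] mem[of m m] by (cases "j = m") (auto simp: boundary_def)
    qed
    then show ?thesis using m(1) by auto
  qed
  have conn: "v \<in> ?B j" if "i \<le> j" "j \<le> k" "k < ?n" "v \<in> ?B i" "v \<in> ?B k" for v i j k
  proof (cases "i = j \<or> j = k")
    case False
    then have lt: "i < j" "j < k" using that by auto
    have sub: "set (take i vs) \<subseteq> set (take j vs)" "set (take j vs) \<subseteq> set (take k vs)"
      using lt by (auto intro!: set_take_subset_set_take)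
    have vj: "v \<in> set (take j vs)"
      using that(4) sub lt that(3) mem[of i j] by (auto simp: boundary_def)
    then have "v \<noteq> vs ! k"
      using sub mem[of k k] that(3) by auto
    then have "v \<in> boundary E (set (take k vs))" using that(5) by auto
    \<comment> \<open>An edge through \<open>v\<close> that is not inside the first \<open>k\<close>
      vertices is not inside the first \<open>j\<close> either.\<close>
    then have "v \<in> boundary E (set (take j vs))"
      using sub vj by (auto simp: boundary_def)
    then show ?thesis by auto
  qed (use that in auto)
  show ?thesis
    unfolding path_decomposition_def
  proof (intro conjI)
    show "\<forall>b\<in>set (map ?B [0..<?n]). b \<subseteq> V"
      using vs(2) by (auto simp: boundary_def dest: in_set_takeD)
    show "\<forall>v\<in>V. \<forall>i j k. i \<le> j \<and> j \<le> k \<and> k < length (map ?B [0..<?n]) \<and>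
        v \<in> map ?B [0..<?n] ! i \<and> v \<in> map ?B [0..<?n] ! k \<longrightarrow> v \<in> map ?B [0..<?n] ! j"
    proof (intro ballI allI impI, elim conjE)
      fix v i j k
      assume *: "i \<le> j" "j \<le> k" "k < length (map ?B [0..<?n])"
        "v \<in> map ?B [0..<?n] ! i" "v \<in> map ?B [0..<?n] ! k"
      then have "i < ?n" "j < ?n" "k < ?n" by auto
      then have "v \<in> ?B j" using conn[of i j k v] * by simp
      then show "v \<in> map ?B [0..<?n] ! j" using \<open>j < ?n\<close> by simp
    qed
  qed (use vs cover in auto)
qed

text \<open>Pathwidth is a least value, so the decomposition read off the order bounds it from
  above. The required prefix stops just before the vertex of a largest bag.\<close>

lemma exists_prefix_large_boundary:
  assumes vs: "distinct vs" "set vs = V" "vs \<noteq> []"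
    and E: "\<And>e. e \<in> E \<Longrightarrow> e \<subseteq> V" "{} \<notin> E"
  obtains p q where "vs = p @ q" "hyp_pathwidth V E \<le> card (boundary E (set p))"
proof -
  let ?B = "\<lambda>i. insert (vs ! i) (boundary E (set (take i vs)))"
  let ?bs = "map ?B [0..<length vs]"
  have "hyp_pathwidth V E \<le> decomposition_width ?bs"
    unfolding hyp_pathwidth_def
    by (rule Least_le) (use path_decomposition_of_order[OF assms] in blast)
  moreover have "Max (card ` set ?bs) \<in> card ` set ?bs"
    by (rule Max_in) (use vs(3) in auto)
  then obtain i where i: "Max (card ` set ?bs) = card (?B i)" by auto
  \<comment> \<open>The vertex \<open>vs ! i\<close> added to the boundary is offset by the minus
    one in the width.\<close>
  have "decomposition_width ?bs \<le> card (boundary E (set (take i vs)))"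
    unfolding decomposition_width_def i by (simp add: card_insert_if boundary_def)
  ultimately show ?thesis
    by (intro that[of "take i vs" "drop i vs"]) auto
qed

text \<open>Each boundary vertex lies in a cut edge, and a cut edge accounts for at most
  \<open>a\<close> vertices.\<close>

lemma card_boundary_le:
  assumes "finite E" "\<And>e. e \<in> E \<Longrightarrow> finite e \<and> card e \<le> a"
  shows "card (boundary E P) \<le> card (cut_edges E P) * a"
proof -
  have fin: "finite (cut_edges E P)" using assms(1) by (auto simp: cut_edges_def)
  have "boundary E P \<subseteq> \<Union> (cut_edges E P)"
    by (auto simp: boundary_def cut_edges_def)
  moreover have "finite (\<Union> (cut_edges E P))"
    using fin assms(2) by (auto simp: cut_edges_def)
  ultimately have "card (boundary E P) \<le> card (\<Union>e\<in>cut_edges E P. e)"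
    by (simp add: card_mono)
  also have "\<dots> \<le> (\<Sum>e\<in>cut_edges E P. card e)" by (rule card_UN_le[OF fin])
  also have "\<dots> \<le> card (cut_edges E P) * a"
    using sum_bounded_above[of "cut_edges E P" card a] assms(2) by (auto simp: cut_edges_def)
  finally show ?thesis .
qed

section \<open>Independent clauses\<close>

lemma card_UN_le_mult:
  assumes "finite A" "card A \<le> m" "\<And>x. x \<in> A \<Longrightarrow> card (F x) \<le> n"
  shows "card (\<Union>x\<in>A. F x) \<le> m * n"
proof -
  have "card (\<Union>x\<in>A. F x) \<le> (\<Sum>x\<in>A. card (F x))" by (rule card_UN_le[OF assms(1)])
  also have "\<dots> \<le> card A * n" using sum_bounded_above[of A "\<lambda>x. card (F x)" n] assms(3) by simp
  also have "\<dots> \<le> m * n" using assms(2) by simp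
  finally show ?thesis .
qed

text \<open>An inclusion-maximal independent set dominates \<open>C\<close>: its neighbourhoods,
  each of size at most \<open>m\<close>, cover \<open>C\<close>.\<close>

lemma exists_large_independent_subset:
  assumes fin: "finite C"
    and refl: "\<And>x. x \<in> C \<Longrightarrow> R x x" and sym: "\<And>x y. R x y \<Longrightarrow> R y x"
    and nbrs: "\<And>x. x \<in> C \<Longrightarrow> card {y \<in> C. R x y} \<le> m"
  obtains I where "I \<subseteq> C" "\<forall>x\<in>I. \<forall>y\<in>I. R x y \<longrightarrow> x = y" "card C \<le> card I * m"
proof -
  define \<I> where "\<I> = {I. I \<subseteq> C \<and> (\<forall>x\<in>I. \<forall>y\<in>I. R x y \<longrightarrow> x = y)}"
  have "finite \<I>" using fin by (auto simp: \<I>_def)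
  moreover have "{} \<in> \<I>" by (auto simp: \<I>_def)
  ultimately have "\<exists>I\<in>\<I>. {} \<subseteq> I \<and> (\<forall>J\<in>\<I>. I \<subseteq> J \<longrightarrow> I = J)"
    by (rule finite_has_maximal2)
  then obtain I where I: "I \<in> \<I>" and max: "\<forall>J\<in>\<I>. I \<subseteq> J \<longrightarrow> I = J"
    by (elim bexE conjE)
  have "C \<subseteq> (\<Union>x\<in>I. {y \<in> C. R x y})"
  proof
    fix y assume y: "y \<in> C"
    show "y \<in> (\<Union>x\<in>I. {y \<in> C. R x y})"
    proof (rule ccontr)
      assume n: "\<not> ?thesis"
      then have nR: "\<not> R x y" if "x \<in> I" for x using that y by blast
      then have nR': "\<not> R y x" if "x \<in> I" for x using that sym[of y x] by blast
      \<comment> \<open>An element related to nothing in \<open>I\<close> can be added, so by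
        maximality it is already in \<open>I\<close>; but then it is related to itself.\<close>
      have "insert y I \<in> \<I>" using I y nR nR' by (auto simp: \<I>_def)
      then have "I = insert y I" using max by blast
      then have "y \<in> I" by blast
      then show False using nR refl[OF y] by blast
    qed
  qed
  moreover have "finite (\<Union>x\<in>I. {y \<in> C. R x y})" by (rule finite_subset[OF _ fin]) auto
  ultimately have "card C \<le> card (\<Union>x\<in>I. {y \<in> C. R x y})" by (simp add: card_mono)
  also have "\<dots> \<le> card I * m"
    using I nbrs finite_subset[OF _ fin] by (intro card_UN_le_mult) (auto simp: \<I>_def)
  finally have "card C \<le> card I * m" .
  moreover have "I \<subseteq> C" "\<forall>x\<in>I. \<forall>y\<in>I. R x y \<longrightarrow> x = y"
    using I by (simp_all add: \<I>_def)
  ultimately show ?thesis by (intro that[of I])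
qed

text \<open>To reach \<open>g\<close> from \<open>e\<close>, choose a vertex of \<open>e\<close>, an
  edge \<open>f\<close> through it, a vertex of \<open>f\<close> and an edge through that one: at
  most \<open>a\<close>, \<open>d\<close>, \<open>a\<close> and \<open>d\<close> choices.\<close>

lemma card_edges_at_distance_two:
  assumes E: "\<And>e. e \<in> E \<Longrightarrow> finite e \<and> card e \<le> a" "finite E"
    and d: "\<And>e v. e \<in> E \<Longrightarrow> v \<in> e \<Longrightarrow> card {f \<in> E. v \<in> f} \<le> d"
    and e: "e \<in> E"
  shows "card {g \<in> E. \<exists>f\<in>E. f \<inter> e \<noteq> {} \<and> f \<inter> g \<noteq> {}} \<le> a * (d * (a * d))"
proof -
  let ?N = "\<lambda>v. {f \<in> E. v \<in> f}"
  have "{g \<in> E. \<exists>f\<in>E. f \<inter> e \<noteq> {} \<and> f \<inter> g \<noteq> {}} = (\<Union>v\<in>e. \<Union>f\<in>?N v. \<Union>u\<in>f. ?N u)"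
    by auto
  moreover have "card (\<Union>v\<in>e. \<Union>f\<in>?N v. \<Union>u\<in>f. ?N u) \<le> a * (d * (a * d))"
    using E d e by (intro card_UN_le_mult) auto
  ultimately show ?thesis by simp
qed

section \<open>Separating subfunctions\<close>

lemma nf_eval_CNF_dual: "nf_eval (CNF E) (\<lambda>x. \<not> \<sigma> x) \<longleftrightarrow> \<not> nf_eval (DNF E) \<sigma>"
  by auto

text \<open>Inside \<open>P\<close> the valuation sets the chosen clauses to 1; outside
  \<open>P\<close> it completes \<open>c\<close> and nothing else, in the same way for
  \<open>S\<close> and \<open>T\<close>. So \<open>c\<close> is satisfied with \<open>S\<close>,
  while independence and minimality keep every clause from being satisfied with
  \<open>T\<close>.\<close>

lemma DNF_separates:
  fixes P c
  defines "\<sigma> \<equiv> \<lambda>U x. if x \<in> P then x \<in> \<Union> U else x \<in> c"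
  assumes antichain: "\<forall>e\<in>E. \<forall>e'\<in>E. e \<subseteq> e' \<longrightarrow> e = e'" and "{} \<notin> E"
    and I: "I \<subseteq> cut_edges E P"
    and indep: "\<forall>c\<in>I. \<forall>c'\<in>I. (\<exists>e\<in>E. e \<inter> c \<noteq> {} \<and> e \<inter> c' \<noteq> {}) \<longrightarrow> c = c'"
    and ST: "S \<subseteq> I" "T \<subseteq> I" "c \<in> S" "c \<notin> T"
  shows "nf_eval (DNF E) (\<sigma> S)" "\<not> nf_eval (DNF E) (\<sigma> T)"
proof -
  have c: "c \<in> E" "c \<inter> P \<noteq> {}" "c \<in> I" using ST I by (auto simp: cut_edges_def)
  have "\<forall>x\<in>c. \<sigma> S x" using ST(3) by (auto simp: \<sigma>_def)
  then show "nf_eval (DNF E) (\<sigma> S)" using c(1) by auto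
  show "\<not> nf_eval (DNF E) (\<sigma> T)"
  proof
    assume "nf_eval (DNF E) (\<sigma> T)"
    then obtain e where e: "e \<in> E" and true: "\<And>x. x \<in> e \<Longrightarrow> \<sigma> T x" by auto
    show False
    proof (cases "e \<subseteq> P")
      case True
      obtain x where "x \<in> e" using e \<open>{} \<notin> E\<close> by fastforce
      then obtain c' where c': "c' \<in> T" "x \<in> c'"
        using true[of x] True by (auto simp: \<sigma>_def subset_iff)
      \<comment> \<open>All members of \<open>T\<close> that cover vertices of \<open>e\<close> are
        met by \<open>e\<close>, so independence makes them one clause \<open>c'\<close>. Minimality
        then gives \<open>e = c'\<close>, although \<open>c'\<close> is not inside
        \<open>P\<close>.\<close>
      have "e \<subseteq> c'"
      proof
        fix y assume y: "y \<in> e"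
        then obtain c'' where c'': "c'' \<in> T" "y \<in> c''"
          using true[of y] True by (auto simp: \<sigma>_def subset_iff)
        then have "c'' = c'" using indep ST(2) c' e y \<open>x \<in> e\<close> by blast
        then show "y \<in> c'" using c'' by simp
      qed
      moreover have "c' \<in> E" "\<not> c' \<subseteq> P" using c' ST I by (auto simp: cut_edges_def)
      ultimately show False using antichain e True by blast
    next
      case False
      then obtain x where x: "x \<in> e" "x \<in> c" "x \<notin> P"
        using true by (auto simp: \<sigma>_def split: if_splits)
      \<comment> \<open>A vertex of \<open>e\<close> in \<open>P\<close> would come from some
        \<open>c'\<close> in \<open>T\<close>. As \<open>e\<close> also meets \<open>c\<close> in
        \<open>x\<close>, independence gives \<open>c' = c\<close>, which is not in
        \<open>T\<close>.\<close>
      have "y \<notin> P" if y: "y \<in> e" for y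
      proof
        assume "y \<in> P"
        then obtain c' where c': "c' \<in> T" "y \<in> c'" using true[OF y] by (auto simp: \<sigma>_def)
        then have "c' = c" using indep ST(2) c e x y by blast
        then show False using c' ST by simp
      qed
      \<comment> \<open>Outside \<open>P\<close> only \<open>c\<close> is set to 1. Minimality gives
        \<open>e = c\<close>, yet the cut clause \<open>c\<close> meets \<open>P\<close>.\<close>
      then have "e \<subseteq> c" using true by (auto simp: \<sigma>_def)
      then have "e = c" using antichain e c(1) by simp
      then show False using \<open>\<And>y. y \<in> e \<Longrightarrow> y \<notin> P\<close> c(2) by blast
    qed
  qed
qed

text \<open>The prefix valuation \<open>\<nu> U\<close> is fixed by \<open>U\<close> alone, as
  counting nodes of a level requires. Only the completion outside \<open>P\<close> depends on the
  pair, through a clause \<open>c\<close> in exactly one of \<open>S\<close> and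
  \<open>T\<close>.\<close>

lemma monotone_nf_separates:
  assumes antichain: "\<forall>e\<in>E. \<forall>e'\<in>E. e \<subseteq> e' \<longrightarrow> e = e'" and ne: "{} \<notin> E"
    and I: "I \<subseteq> cut_edges E P"
    and indep: "\<forall>c\<in>I. \<forall>c'\<in>I. (\<exists>e\<in>E. e \<inter> c \<noteq> {} \<and> e \<inter> c' \<noteq> {}) \<longrightarrow> c = c'"
    and E: "E = nf_clauses \<phi>"
  obtains \<nu> where "\<forall>S T. S \<subseteq> I \<longrightarrow> T \<subseteq> I \<longrightarrow> S \<noteq> T \<longrightarrow> (\<exists>\<sigma> \<tau>. nf_eval \<phi> \<sigma> \<noteq> nf_eval \<phi> \<tau> \<and>
      (\<forall>x\<in>P. \<sigma> x = \<nu> S x \<and> \<tau> x = \<nu> T x) \<and> (\<forall>x. x \<notin> P \<longrightarrow> \<sigma> x = \<tau> x))"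
proof -
  define s where "s = (\<lambda>c U x. if x \<in> P then x \<in> \<Union> U else x \<in> c)"
  have sep: "\<exists>c. nf_eval (DNF E) (s c S) \<noteq> nf_eval (DNF E) (s c T)"
    if ST: "S \<subseteq> I" "T \<subseteq> I" "S \<noteq> T" for S T
  proof -
    consider c where "c \<in> S" "c \<notin> T" | c where "c \<in> T" "c \<notin> S" using ST(3) by blast
    then show ?thesis
    proof cases
      case 1
      then show ?thesis
        using DNF_separates[OF antichain ne I indep ST(1,2), where c = c] unfolding s_def by blast
    next
      case 2
      then show ?thesis
        using DNF_separates[OF antichain ne I indep ST(2,1), where c = c] unfolding s_def by blast
    qed
  qed
  show thesis
  proof (cases \<phi>)
    case (DNF C)
    show thesis
    proof (rule that[of "\<lambda>U x. x \<in> \<Union> U"], intro allI impI)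
      fix S T assume "S \<subseteq> I" "T \<subseteq> I" "S \<noteq> T"
      then obtain c where "nf_eval (DNF E) (s c S) \<noteq> nf_eval (DNF E) (s c T)" using sep by blast
      then show "\<exists>\<sigma> \<tau>. nf_eval \<phi> \<sigma> \<noteq> nf_eval \<phi> \<tau> \<and>
          (\<forall>x\<in>P. \<sigma> x = (x \<in> \<Union> S) \<and> \<tau> x = (x \<in> \<Union> T)) \<and> (\<forall>x. x \<notin> P \<longrightarrow> \<sigma> x = \<tau> x)"
        using E DNF by (intro exI[of _ "s c S"] exI[of _ "s c T"]) (auto simp: s_def)
    qed
  next
    case (CNF C)
    show thesis
    \<comment> \<open>By De Morgan duality, the CNF on the complemented valuations takes the negated
      DNF values, which still differ.\<close>
    proof (rule that[of "\<lambda>U x. x \<notin> \<Union> U"], intro allI impI)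
      fix S T assume "S \<subseteq> I" "T \<subseteq> I" "S \<noteq> T"
      then obtain c where "nf_eval (DNF E) (s c S) \<noteq> nf_eval (DNF E) (s c T)" using sep by blast
      then have "nf_eval \<phi> (\<lambda>x. \<not> s c S x) \<noteq> nf_eval \<phi> (\<lambda>x. \<not> s c T x)"
        using E CNF nf_eval_CNF_dual by (metis monotone_nf.sel(2))
      then show "\<exists>\<sigma> \<tau>. nf_eval \<phi> \<sigma> \<noteq> nf_eval \<phi> \<tau> \<and>
          (\<forall>x\<in>P. \<sigma> x = (x \<notin> \<Union> S) \<and> \<tau> x = (x \<notin> \<Union> T)) \<and> (\<forall>x. x \<notin> P \<longrightarrow> \<sigma> x = \<tau> x)"
        by (intro exI[of _ "\<lambda>x. \<not> s c S x"] exI[of _ "\<lambda>x. \<not> s c T x"]) (auto simp: s_def)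
    qed
  qed
qed

section \<open>The width bound from cuts, independence and separation\<close>

theorem theorem15:
  fixes V :: "'v set" and \<phi> :: "'v monotone_nf"
    and vs :: "'v list" and D :: "('v, 'n) bdd" and a d :: nat
  assumes "monotone_nf_on V \<phi>"
    and "a = hyp_arity (nf_clauses \<phi>)"
    and "d = hyp_degree V (nf_clauses \<phi>)"
    and "obdd_for V vs D \<phi>"
  shows "obdd_width vs D \<ge> 2 ^ (hyp_pathwidth V (nf_clauses \<phi>) div (a ^ 3 * d ^ 2))"
proof -
  define E where "E = nf_clauses \<phi>"
  have finV: "finite V" and EV: "\<And>e. e \<in> E \<Longrightarrow> e \<subseteq> V"
    and antichain: "\<forall>e\<in>E. \<forall>e'\<in>E. e \<subseteq> e' \<longrightarrow> e = e'"
    and "\<exists>c\<in>E. c \<noteq> {}"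
    using assms(1) by (auto simp: monotone_nf_on_def E_def)
  \<comment> \<open>An empty clause would be contained in the non-empty one, against
    minimality.\<close>
  then have ne: "{} \<notin> E" by blast
  have finE: "finite E" using finV EV by (meson finite_Pow_iff finite_subset PowI subsetI)
  have arity: "finite e \<and> card e \<le> a" if "e \<in> E" for e
    using that finE finite_subset[OF EV finV] unfolding assms(2) hyp_arity_def E_def[symmetric]
    by simp
  have degree: "card {f \<in> E. v \<in> f} \<le> d" if "e \<in> E" "v \<in> e" for e v
    using that EV finV unfolding assms(3) hyp_degree_def E_def[symmetric]
    by (intro Max_ge) auto
  have D: "obdd V vs D" "captures V D (nf_eval \<phi>)"
    using assms(4) by (auto simp: obdd_for_def)
  then have vs: "distinct vs" "set vs = V" by (auto simp: obdd_def)
  have "vs \<noteq> []" using vs(2) EV \<open>\<exists>c\<in>E. c \<noteq> {}\<close> by fastforce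
  then obtain p q where pq: "vs = p @ q"
    and pw: "hyp_pathwidth V E \<le> card (boundary E (set p))"
    using exists_prefix_large_boundary[OF vs _ EV ne] by blast
  define C where "C = cut_edges E (set p)"
  \<comment> \<open>Bounds the clauses related to a given one; the remaining factor \<open>a\<close>
    of \<open>a ^ 3 * d ^ 2\<close> comes from passing from boundary vertices to cut
    clauses.\<close>
  define m where "m = a * (d * (a * d))"
  define R where "R = (\<lambda>c g. \<exists>f\<in>E. f \<inter> c \<noteq> {} \<and> f \<inter> g \<noteq> {})"
  have CE: "C \<subseteq> E" by (auto simp: C_def cut_edges_def)
  have nbrs: "card {g \<in> C. R c g} \<le> m" if "c \<in> C" for c
  proof -
    have "card {g \<in> C. R c g} \<le> card {g \<in> E. R c g}"
      using CE finE by (intro card_mono) auto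
    also have "\<dots> \<le> m"
      unfolding R_def m_def using CE that
      by (intro card_edges_at_distance_two[OF arity finE degree]) auto
    finally show ?thesis .
  qed
  \<comment> \<open>The clause itself is the witness \<open>f\<close>, being non-empty.\<close>
  have refl: "R c c" if "c \<in> C" for c 
  proof -
    have "c \<in> E" "c \<inter> c \<noteq> {}" using that CE ne by auto
    then show ?thesis unfolding R_def by blast
  qed
  have sym: "R g c" if "R c g" for c g using that by (auto simp: R_def)
  obtain I where I: "I \<subseteq> C" and indep: "\<forall>x\<in>I. \<forall>y\<in>I. R x y \<longrightarrow> x = y"
    and card_I: "card C \<le> card I * m"
    by (rule exists_large_independent_subset[OF finite_subset[OF CE finE] refl sym nbrs])
  note pw
  also have "card (boundary E (set p)) \<le> card C * a"
    unfolding C_def by (rule card_boundary_le[OF finE arity])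
  also have "\<dots> \<le> card I * m * a" using card_I by simp
  also have "\<dots> = card I * (a ^ 3 * d ^ 2)"
    by (simp add: m_def power2_eq_square power3_eq_cube)
  finally have "hyp_pathwidth V E div (a ^ 3 * d ^ 2) \<le> card I * (a ^ 3 * d ^ 2) div (a ^ 3 * d ^ 2)"
    by (rule div_le_mono)
  \<comment> \<open>Division by zero yields zero, so the bound also holds for a zero
    denominator.\<close>
  also have "\<dots> \<le> card I" by (cases "a ^ 3 * d ^ 2 = 0") simp_all
  finally have "hyp_pathwidth V E div (a ^ 3 * d ^ 2) \<le> card I" .
  then have "(2::nat) ^ (hyp_pathwidth V E div (a ^ 3 * d ^ 2)) \<le> 2 ^ card I" by simp
  \<comment> \<open>The subsets of \<open>I\<close> index the prefix valuations: distinct subsets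
    lead to distinct nodes at the level of \<open>p\<close>.\<close>
  also have "\<dots> = card (Pow I)"
    using finite_subset[OF I finite_subset[OF CE finE]] by (simp add: card_Pow)
  also have "\<dots> \<le> obdd_width vs D"
  proof -
    have "\<forall>c\<in>I. \<forall>c'\<in>I. (\<exists>e\<in>E. e \<inter> c \<noteq> {} \<and> e \<inter> c' \<noteq> {}) \<longrightarrow> c = c'"
      using indep by (simp add: R_def)
    then obtain \<nu> where \<nu>: "\<forall>S T. S \<subseteq> I \<longrightarrow> T \<subseteq> I \<longrightarrow> S \<noteq> T \<longrightarrow> (\<exists>\<sigma> \<tau>. nf_eval \<phi> \<sigma> \<noteq> nf_eval \<phi> \<tau> \<and>
      (\<forall>x\<in>set p. \<sigma> x = \<nu> S x \<and> \<tau> x = \<nu> T x) \<and> (\<forall>x. x \<notin> set p \<longrightarrow> \<sigma> x = \<tau> x))"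
      by (rule monotone_nf_separates[OF antichain ne I[unfolded C_def] _ E_def])
    show ?thesis
      unfolding pq by (rule card_distinguishable_le_width[where \<nu> = \<nu>, OF D[unfolded pq]]) (use \<nu> in simp)
  qed
  finally show ?thesis by (simp add: E_def)
qed

end
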